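(* For every natural number $r\in\{1,2,3,\dots\}$, $$\sum_{n=1}^{\infty}\frac{1}{(4\sqrt{5})^n\alpha^{rn}F_r^n}\binom{2n}{n}H_n=\frac{2\sqrt{\alpha^rF_r\sqrt{5}}}{\sqrt{\alpha^rF_r\sqrt{5}-1}}\ln \left(\frac{\sqrt{\alpha^rF_r\sqrt{5}}+\sqrt{\alpha^rF_r\sqrt{5}-1}}{2\sqrt{\alpha^rF_r\sqrt{5}-1}}\right).$$
   Context: $H_n=\sum_{k=1}^n \frac1k$ is the $n$-th harmonic number. $\alpha=\frac{1+\sqrt5}{2}$ is the golden ratio. $F_n$ is the $n$-th Fibonacci number: $F_0=0$, $F_1=1$, $F_n=F_{n-1}+F_{n-2}$ for $n\ge2$. *)

theory Defs
  imports "HOL-Analysis.Analysis" "HOL-Number_Theory.Fib"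
begin

definition golden_ratio :: real where
  "golden_ratio = (1 + sqrt 5) / 2"

end

theory Submission
  imports Defs
begin

text \<open>
  The series is a value of a power series with a closed form. Let \<open>a n\<close> be the normalised central
  binomial coefficient \<open>binom(2n, n) / 4^n\<close>. Then, for \<open>\<bar>t\<bar> < 1\<close> and \<open>s = sqrt (1 - t)\<close>,
  \[ \sum_n a_n H_n t^n = \frac{2}{s} \ln\frac{1 + s}{2 s}, \]
  (\<open>central_harm_gf_closed_form\<close>), and the theorem is the case \<open>t = 1 / y\<close> with
  \<open>y = \<alpha>^r F_r sqrt 5\<close>, where \<open>y > 1\<close> because \<open>\<alpha>\<close> and \<open>F_r\<close> are at least \<open>1\<close> and
  \<open>sqrt 5 > 1\<close>.

  The closed form comes from a differential equation. The recurrence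
  \<open>(n + 1) a (n + 1) = (n + 1/2) a n\<close> turns into
  \<open>(n + 1) b (n + 1) = (n + 1/2) b n + a (n + 1)\<close> for \<open>b n = a n * H n\<close>. Hence the sum \<open>G\<close> of the
  \<open>b n * t^n\<close> satisfies \<open>(1 - t) G' - G / 2 = D\<close>, where \<open>D\<close> is the sum of the \<open>a (n + 1) * t^n\<close>
  (\<open>central_harm_gf_ODE\<close>).
  The binomial series gives \<open>1 / s\<close> as the sum of the \<open>a n * t^n\<close>, from which
  \<open>D = 1 / (s * (1 + s))\<close> (\<open>central_coeff_Suc_sums\<close>). With the integrating factor \<open>s\<close> this reads
  \<open>(s G)' = 1 / (s\<^sup>2 (1 + s))\<close>, which is also the derivative of \<open>2 ln ((1 + s) / (2 s))\<close>; both
  functions vanish at \<open>t = 0\<close>.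
\<close>

section \<open>Normalised central binomial coefficients\<close>

definition central_coeff :: "nat \<Rightarrow> real" where
  "central_coeff n = real ((2 * n) choose n) / 4 ^ n"

lemma central_coeff_0 [simp]: "central_coeff 0 = 1"
  by (simp add: central_coeff_def)

lemma central_coeff_Suc:
  "real (Suc n) * central_coeff (Suc n) = (real n + 1 / 2) * central_coeff n"
proof -
  have "Suc n * (2 * Suc n choose Suc n) = 2 * Suc n * (Suc (2 * n) choose n)"
    using Suc_times_binomial[of n "Suc (2 * n)"] by simp
  moreover have "Suc n * (Suc (2 * n) choose n) = Suc (2 * n) * ((2 * n) choose n)"
    using Suc_times_binomial_add[of n n] Suc_times_binomial[of n "2 * n"]
    by (simp add: mult_2)
  ultimately have "Suc n * (2 * Suc n choose Suc n) = 2 * (Suc (2 * n) * ((2 * n) choose n))"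
    by (metis mult.assoc)
  then have "real (Suc n) * real (2 * Suc n choose Suc n)
               = 2 * (real (Suc (2 * n)) * real ((2 * n) choose n))"
    by (metis of_nat_mult of_nat_numeral)
  then show ?thesis
    unfolding central_coeff_def by (simp add: field_simps del: binomial_Suc_Suc)
qed

lemma central_coeff_eq_gbinomial: "central_coeff n = (-1) ^ n * ((-1/2) gchoose n)"
proof (induction n)
  case (Suc n)
  have "real (Suc n) * ((-1/2) gchoose Suc n) = - ((real n + 1 / 2) * ((-1/2) gchoose n))"
    using gbinomial_mult_1[of "-1/2 :: real" n] unfolding distrib_right by linarith
  then have "real (Suc n) * ((-1) ^ Suc n * ((-1/2 :: real) gchoose Suc n))
          = (real n + 1 / 2) * ((-1) ^ n * ((-1/2) gchoose n))"
    by (cases "even n") (simp_all del: of_nat_Suc)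
  then have "real (Suc n) * central_coeff (Suc n)
      = real (Suc n) * ((-1) ^ Suc n * ((-1/2 :: real) gchoose Suc n))"
    using central_coeff_Suc[of n] Suc.IH by metis
  then show ?case
    by (metis mult_cancel_left of_nat_eq_0_iff nat.distinct(1))
qed simp

lemma central_coeff_nonneg: "0 \<le> central_coeff n"
  by (simp add: central_coeff_def)

lemma central_coeff_le_1: "central_coeff n \<le> 1"
proof -
  have "(2 * n) choose n \<le> 4 ^ n"
    using binomial_le_pow2[of "2 * n" n] by (simp add: power_mult)
  then have "real ((2 * n) choose n) \<le> real (4 ^ n)"
    by (rule of_nat_mono)
  then show ?thesis
    by (simp add: central_coeff_def)
qed

lemma harm_le_real: "harm n \<le> real n"
proof (induction n)
  case (Suc n)
  have "inverse (real (Suc n)) \<le> 1"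
    by (simp add: field_simps)
  with Suc show ?case
    by (simp add: harm_Suc)
qed (simp add: harm_def)

section \<open>Power series with central binomial coefficients\<close>

lemma central_coeff_sums:
  fixes t :: real
  assumes "\<bar>t\<bar> < 1"
  shows "(\<lambda>n. central_coeff n * t ^ n) sums (1 / sqrt (1 - t))"
proof -
  have "(\<lambda>n. ((-1/2) gchoose n) * (- t) ^ n) sums (1 + (- t)) powr (-1/2)"
    using assms by (intro gen_binomial_real) auto
  moreover have "((-1/2) gchoose n) * (- t) ^ n = central_coeff n * t ^ n" for n
    by (simp add: central_coeff_eq_gbinomial power_minus[of t])
  moreover have "(1 + (- t)) powr (-1/2) = 1 / sqrt (1 - t)"
    using assms by (simp add: powr_minus_divide powr_half_sqrt)
  ultimately show ?thesis
    by simp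
qed

text \<open>The shifted series is \<open>(1 / s - 1) / t\<close> for \<open>s = sqrt (1 - t)\<close>; cancelling
  \<open>t = (1 - s) (1 + s)\<close> gives a form that is also correct at \<open>t = 0\<close>.\<close>

lemma central_coeff_Suc_sums:
  fixes t :: real
  assumes t: "\<bar>t\<bar> < 1"
  shows "(\<lambda>n. central_coeff (Suc n) * t ^ n) sums (1 / (sqrt (1 - t) * (1 + sqrt (1 - t))))"
proof (cases "t = 0")
  case True
  then show ?thesis
    using powser_sums_zero[of "\<lambda>n. central_coeff (Suc n)"] central_coeff_Suc[of 0] by simp
next
  case False
  define s where "s = sqrt (1 - t)"
  have s: "s > 0" "t = (1 - s) * (1 + s)"
    using t by (simp_all add: s_def algebra_simps flip: power2_eq_square)
  have "(\<lambda>n. central_coeff (Suc n) * t ^ Suc n) sums (1 / s - 1)"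
    using central_coeff_sums[OF t] by (subst sums_Suc_iff) (simp add: s_def)
  from sums_divide[OF this, of t] False
  have "(\<lambda>n. central_coeff (Suc n) * t ^ n) sums ((1 / s - 1) / t)"
    by simp
  moreover have "(1 / s - 1) / t = 1 / (s * (1 + s))"
    using False s by (simp add: divide_simps)
  ultimately show ?thesis
    by (simp add: s_def)
qed

lemma central_coeff_harm_summable:
  fixes t :: real
  assumes "\<bar>t\<bar> < 1"
  shows "summable (\<lambda>n. central_coeff n * harm n * t ^ n)"
proof (rule summable_comparison_test')
  show "summable (\<lambda>n. real (Suc n) * \<bar>t\<bar> ^ n)"
    using geometric_deriv_sums[of "\<bar>t\<bar>"] assms by (simp add: sums_iff)
next
  fix n :: nat
  have "central_coeff n * harm n \<le> 1 * real (Suc n)"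
    using harm_le_real[of n]
    by (intro mult_mono) (auto simp: central_coeff_le_1 central_coeff_nonneg harm_nonneg)
  then show "norm (central_coeff n * harm n * t ^ n) \<le> real (Suc n) * \<bar>t\<bar> ^ n"
    by (simp add: abs_mult power_abs central_coeff_nonneg harm_nonneg mult_right_mono)
qed

section \<open>The generating function with harmonic numbers\<close>

definition central_harm_gf :: "real \<Rightarrow> real" where
  "central_harm_gf t = (\<Sum>n. central_coeff n * harm n * t ^ n)"

text \<open>This is the coefficient recurrence of the terms \<open>central_coeff n * harm n\<close>, read as a
  differential equation.\<close>

lemma central_harm_gf_ODE:
  fixes t :: real
  assumes t: "\<bar>t\<bar> < 1"
  obtains G' where "(central_harm_gf has_field_derivative G') (at t)"
    and "(1 - t) * G' = central_harm_gf t / 2 + 1 / (sqrt (1 - t) * (1 + sqrt (1 - t)))"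
proof -
  define b :: "nat \<Rightarrow> real" where "b n = central_coeff n * harm n" for n
  define G' where "G' = (\<Sum>n. diffs b n * t ^ n)"
  have sm: "summable (\<lambda>n. b n * x ^ n)" if "norm x < 1" for x
    using central_coeff_harm_summable[of x] that by (simp add: b_def)
  have deriv: "(central_harm_gf has_field_derivative G') (at t)"
    unfolding central_harm_gf_def[abs_def] G'_def b_def[symmetric]
    by (rule termdiffs_strong'[where K = 1]) (use sm t in auto)
  have smd: "summable (\<lambda>n. diffs b n * t ^ n)"
    by (rule termdiff_converges[where K = 1]) (use sm t in auto)
  have rec: "diffs b n = real n * b n + b n / 2 + central_coeff (Suc n)" for n
  proof -
    have "diffs b n = (real (Suc n) * central_coeff (Suc n)) * harm n + central_coeff (Suc n)"
      by (simp add: diffs_def b_def harm_Suc field_simps del: of_nat_Suc)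
    also have "\<dots> = real n * b n + b n / 2 + central_coeff (Suc n)"
      unfolding central_coeff_Suc by (simp add: b_def algebra_simps)
    finally show ?thesis .
  qed
  have "(\<lambda>n. t * (real n * b n * t ^ (n - Suc 0))) sums (t * G')"
    unfolding G'_def by (intro sums_mult diffs_equiv smd)
  moreover have "t * (real n * b n * t ^ (n - Suc 0)) = real n * b n * t ^ n" for n
    by (cases n) simp_all
  ultimately have "(\<lambda>n. real n * b n * t ^ n) sums (t * G')"
    by simp
  moreover have "(\<lambda>n. b n * t ^ n / 2) sums (central_harm_gf t / 2)"
    unfolding central_harm_gf_def b_def[symmetric]
    by (intro sums_divide summable_sums sm) (use t in auto)
  ultimately have "(\<lambda>n. real n * b n * t ^ n + b n * t ^ n / 2 + central_coeff (Suc n) * t ^ n)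
      sums (t * G' + central_harm_gf t / 2 + 1 / (sqrt (1 - t) * (1 + sqrt (1 - t))))"
    by (intro sums_add central_coeff_Suc_sums t)
  then have "(\<lambda>n. diffs b n * t ^ n)
      sums (t * G' + central_harm_gf t / 2 + 1 / (sqrt (1 - t) * (1 + sqrt (1 - t))))"
    by (simp add: rec algebra_simps)
  then have "G' = t * G' + central_harm_gf t / 2 + 1 / (sqrt (1 - t) * (1 + sqrt (1 - t)))"
    unfolding G'_def by (rule sums_unique[symmetric])
  then have "(1 - t) * G' = central_harm_gf t / 2 + 1 / (sqrt (1 - t) * (1 + sqrt (1 - t)))"
    unfolding left_diff_distrib by linarith
  with deriv show ?thesis
    by (rule that)
qed

text \<open>The function \<open>h\<close> below is \<open>s G - 2 ln ((1 + s) / (2 s))\<close>, with the logarithm split for easier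
  differentiation: \<open>s\<close> is the integrating factor of the differential equation, so \<open>h\<close> is constant.\<close>

lemma central_harm_gf_closed_form:
  fixes t :: real
  assumes t: "\<bar>t\<bar> < 1"
  shows "central_harm_gf t
           = 2 / sqrt (1 - t) * ln ((1 + sqrt (1 - t)) / (2 * sqrt (1 - t)))"
proof -
  define h where "h x = sqrt (1 - x) * central_harm_gf x
    - 2 * (ln (1 + sqrt (1 - x)) - ln (2 * sqrt (1 - x)))" for x :: real
  have "(h has_field_derivative 0) (at x)" if x: "x \<in> {-1<..<1}" for x
  proof -
    have "\<bar>x\<bar> < 1"
      using x by auto
    then obtain G' where G': "(central_harm_gf has_field_derivative G') (at x)"
      and ode: "(1 - x) * G' = central_harm_gf x / 2 + 1 / (sqrt (1 - x) * (1 + sqrt (1 - x)))"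
      by (rule central_harm_gf_ODE)
    define s where "s = sqrt (1 - x)"
    have s: "s > 0" "1 - x = s * s"
      using x by (simp_all add: s_def)
    have ds: "((\<lambda>x. sqrt (1 - x)) has_field_derivative (- 1 / (2 * s))) (at x)"
      using x unfolding s_def by (auto intro!: derivative_eq_intros simp: field_simps)
    have "(h has_field_derivative
        ((- 1 / (2 * s)) * central_harm_gf x + G' * s
          - 2 * ((- 1 / (2 * s)) / (1 + s) - (2 * (- 1 / (2 * s))) / (2 * s)))) (at x)"
      unfolding h_def[abs_def] using s(1) x
      by (auto intro!: derivative_eq_intros ds G' simp: field_simps simp flip: s_def)
    moreover have "(- 1 / (2 * s)) * central_harm_gf x + G' * s
          - 2 * ((- 1 / (2 * s)) / (1 + s) - (2 * (- 1 / (2 * s))) / (2 * s)) = 0"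
    proof -
      have "G' = (central_harm_gf x / 2 + 1 / (s * (1 + s))) / (s * s)"
        using ode s by (simp add: field_simps flip: s_def)
      moreover have "1 + s \<noteq> 0"
        using s by simp
      ultimately show ?thesis
        using s(1) by (simp add: divide_simps) (simp add: algebra_simps)
    qed
    ultimately show ?thesis
      by simp
  qed
  then have "h t = h 0"
    using t by (intro DERIV_isconst3[of "-1" 1 t 0 h]) auto
  moreover have "h 0 = 0"
    by (simp add: h_def central_harm_gf_def powser_zero harm_def)
  moreover have "sqrt (1 - t) > 0" "1 + sqrt (1 - t) > 0"
    using t by (simp_all add: add_pos_nonneg)
  ultimately show ?thesis
    by (simp add: h_def ln_div field_simps)
qed

section \<open>The Fibonacci series\<close>

text \<open>A crude bound that puts the evaluation point \<open>1 / (\<alpha>^r F_r sqrt 5)\<close> inside the unit disc.\<close>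

lemma golden_fib_gt_1:
  assumes "r \<ge> 1"
  shows "1 < golden_ratio ^ r * real (fib r) * sqrt 5"
proof -
  have "sqrt 5 > (1 :: real)"
    by simp
  moreover have "1 \<le> golden_ratio ^ r"
    by (rule one_le_power) (simp add: golden_ratio_def)
  moreover have "1 \<le> real (fib r)"
    using fib_neq_0_nat[of r] assms by linarith
  ultimately show ?thesis
    using mult_mono[of 1 "golden_ratio ^ r" 1 "real (fib r)"]
      mult_le_less_imp_less[of 1 "golden_ratio ^ r * real (fib r)" 1 "sqrt 5"] by simp
qed

theorem mainTheorem1:
  fixes r :: nat
  assumes "r \<ge> 1"
  shows "(\<lambda>k. let n = Suc k in
            1 / ((4 * sqrt 5) ^ n * golden_ratio ^ (r * n) * real (fib r) ^ n)
              * real ((2 * n) choose n) * harm n)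
         sums
         (2 * sqrt (golden_ratio ^ r * real (fib r) * sqrt 5)
            / sqrt (golden_ratio ^ r * real (fib r) * sqrt 5 - 1)
          * ln ((sqrt (golden_ratio ^ r * real (fib r) * sqrt 5)
                  + sqrt (golden_ratio ^ r * real (fib r) * sqrt 5 - 1))
                / (2 * sqrt (golden_ratio ^ r * real (fib r) * sqrt 5 - 1))))"
proof -
  define y where "y = golden_ratio ^ r * real (fib r) * sqrt 5"
  have y: "y > 1"
    unfolding y_def by (rule golden_fib_gt_1[OF assms])
  then have t: "\<bar>1 / y\<bar> < 1"
    by simp
  have root: "sqrt (1 - 1 / y) = sqrt (y - 1) / sqrt y"
    using y by (simp add: diff_divide_distrib flip: real_sqrt_divide)
  have pos: "sqrt y > 0" "sqrt (y - 1) > 0"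
    using y by simp_all
  have "(1 + sqrt (1 - 1 / y)) / (2 * sqrt (1 - 1 / y))
          = (sqrt y + sqrt (y - 1)) / (2 * sqrt (y - 1))"
    unfolding root using pos by (simp add: field_simps)
  moreover have "2 / sqrt (1 - 1 / y) = 2 * sqrt y / sqrt (y - 1)"
    unfolding root by simp
  ultimately have closed: "central_harm_gf (1 / y)
      = 2 * sqrt y / sqrt (y - 1) * ln ((sqrt y + sqrt (y - 1)) / (2 * sqrt (y - 1)))"
    using central_harm_gf_closed_form[OF t] by simp
  have "(\<lambda>n. central_coeff n * harm n * (1 / y) ^ n) sums central_harm_gf (1 / y)"
    unfolding central_harm_gf_def by (rule summable_sums[OF central_coeff_harm_summable[OF t]])
  \<comment> \<open>The term at \<open>n = 0\<close> vanishes because \<open>harm 0 = 0\<close>, so the sum may start at \<open>n = 1\<close>.\<close>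
  then have series: "(\<lambda>k. central_coeff (Suc k) * harm (Suc k) * (1 / y) ^ Suc k)
      sums central_harm_gf (1 / y)"
    by (subst sums_Suc_iff) (simp add: harm_def)
  have coeffs: "central_coeff n * harm n * (1 / y) ^ n
      = 1 / ((4 * sqrt 5) ^ n * golden_ratio ^ (r * n) * real (fib r) ^ n)
          * real ((2 * n) choose n) * harm n" for n
    unfolding central_coeff_def y_def power_mult power_mult_distrib power_divide
    by (simp add: mult_ac flip: power_mult)
  show ?thesis
    using series unfolding coeffs closed unfolding Let_def y_def .
qed

end
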